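(* ($\Delta_0$-Absoluteness Principle.) Let $\mathcal Q$ be a logic on a Hilbert space $\mathcal H$. For any $\Delta_0$-formula $\phi(x_1,\ldots,x_n)$ of the language of set theory and any $u_1,\ldots,u_n\in V^{(\mathcal Q)}$, $$[\![\phi(u_1,\ldots,u_n)]\!]_{\mathcal Q}=[\![\phi(u_1,\ldots,u_n)]\!]_{\mathcal Q(\mathcal H)}.$$
   Context: $\mathcal Q(\mathcal H)$ is the lattice of orthogonal projections on $\mathcal H$ (order by inclusion of ranges, $\wedge,\vee$ and arbitrary $\bigwedge,\bigvee$ via intersection / closed span of union of ranges, $P^\perp=1-P$). $\mathcal A^!$ is the set of projections commuting with every element of $\mathcal A$; a logic is $\mathcal Q\subseteq\mathcal Q(\mathcal H)$ with $\mathcal Q=\mathcal Q^{!!}$ (a complete orthomodular sublattice). $P\Rightarrow Q=P^\perp\vee(P\wedge Q)$, $P\Leftrightarrow Q=(P\Rightarrow Q)\wedge(Q\Rightarrow P)$. For a logic $\mathcal Q$, $V^{(\mathcal Q)}=\bigcup_\alpha V^{(\mathcal Q)}_\alpha$ where $V^{(\mathcal Q)}_\alpha$ is the set of functions $u$ with values in $\mathcal Q$ and $\mathrm{dom}(u)\subseteq\bigcup_{\beta<\alpha}V^{(\mathcal Q)}_\beta$; thus $V^{(\mathcal Q)}\subseteq V^{(\mathcal Q(\mathcal H))}$. A $\Delta_0$-formula is a formula of set theory (with $\in$, $=$) with only bounded quantifiers $\forall x\in y$, $\exists x\in y$. The $\mathcal Q$-valued truth value $[\![\cdot]\!]_{\mathcal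 Q}$ of statements with parameters in $V^{(\mathcal Q)}$ is defined recursively (with lattice operations in $\mathcal Q$): $[\![u=v]\!]_{\mathcal Q}=\bigwedge_{u'\in\mathrm{dom}(u)}(u(u')\Rightarrow[\![u'\in v]\!]_{\mathcal Q})\wedge\bigwedge_{v'\in\mathrm{dom}(v)}(v(v')\Rightarrow[\![v'\in u]\!]_{\mathcal Q})$, $[\![u\in v]\!]_{\mathcal Q}=\bigvee_{v'\in\mathrm{dom}(v)}(v(v')\wedge[\![u=v']\!]_{\mathcal Q})$, $[\![\neg\phi]\!]_{\mathcal Q}=[\![\phi]\!]_{\mathcal Q}^\perp$, $\wedge,\vee,\Rightarrow,\Leftrightarrow$ by the lattice operations, $[\![(\forall x\in u)\phi]\!]_{\mathcal Q}=\bigwedge_{u'\in\mathrm{dom}(u)}(u(u')\Rightarrow[\![\phi(u')]\!]_{\mathcal Q})$, $[\![(\exists x\in u)\phi]\!]_{\mathcal Q}=\bigvee_{u'\in\mathrm{dom}(u)}(u(u')\wedge[\![\phi(u')]\!]_{\mathcal Q})$, $[\![(\forall x)\phi]\!]_{\mathcal Q}=\bigwedge_{u\in V^{(\mathcal Q)}}[\![\phi(u)]\!]_{\mathcal Q}$, $[\![(\exists x)\phi]\!]_{\mathcal Q}=\bigvee_{u\in V^{(\mathcal Q)}}[\![\phi(u)]\!]_{\mathcal Q}$. *)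

theory Defs
  imports "HOL-Analysis.Analysis" "HOL-Library.Multiset"
begin

section \<open>Complex Hilbert spaces\<close>

text \<open>
  Norm and topology are those of the real inner product \<^term>\<open>inner x y = Re (cinner x y)\<close>, so
  that the norm of \<open>x\<close> is the square root of \<^term>\<open>cinner x x\<close>. The form is linear in its second
  argument. The unit law for \<open>scaleC\<close> and the definiteness of \<open>cinner\<close> follow from the axioms of
  the superclasses.
\<close>

class chilbert_space = real_inner + complete_space +
  fixes scaleC :: "complex \<Rightarrow> 'a \<Rightarrow> 'a"  (infixr "*\<^sub>C" 75)
    and cinner :: "'a \<Rightarrow> 'a \<Rightarrow> complex"
  assumes scaleC_add_right: "c *\<^sub>C (x + y) = c *\<^sub>C x + c *\<^sub>C y"
    and scaleC_add_left: "(c + d) *\<^sub>C x = c *\<^sub>C x + d *\<^sub>C x"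
    and scaleC_scaleC: "c *\<^sub>C d *\<^sub>C x = (c * d) *\<^sub>C x"
    and scaleR_scaleC: "r *\<^sub>R x = complex_of_real r *\<^sub>C x"
    and cinner_commute: "cinner x y = cnj (cinner y x)"
    and cinner_add_right: "cinner x (y + z) = cinner x y + cinner x z"
    and cinner_scaleC_right: "cinner x (c *\<^sub>C y) = c * cinner x y"
    and inner_cinner: "inner x y = Re (cinner x y)"

instantiation complex :: chilbert_space
begin
definition scaleC_complex :: "complex \<Rightarrow> complex \<Rightarrow> complex" where "scaleC_complex c x = c * x"
definition cinner_complex :: "complex \<Rightarrow> complex \<Rightarrow> complex" where "cinner_complex x y = cnj x * y"
instance
  by standard (auto simp: scaleC_complex_def cinner_complex_def algebra_simps scaleR_conv_of_real
      inner_complex_def)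
end

global_interpretation cvs: vector_space "scaleC :: complex \<Rightarrow> 'a \<Rightarrow> 'a::chilbert_space"
proof
  show "1 *\<^sub>C x = x" for x :: 'a
    using scaleR_scaleC[of 1 x] by simp
qed (auto simp: scaleC_add_right scaleC_add_left scaleC_scaleC)

lemma cinner_add_left: "cinner (x + y) (z::'a::chilbert_space) = cinner x z + cinner y z"
  by (metis cinner_add_right cinner_commute complex_cnj_add)

lemma cinner_scaleC_left: "cinner (c *\<^sub>C x) (y::'a::chilbert_space) = cnj c * cinner x y"
  by (metis cinner_scaleC_right cinner_commute complex_cnj_mult)

lemma cinner_minus_right: "cinner x (- y::'a::chilbert_space) = - cinner x y"
  using cinner_scaleC_right[of x "-1" y] by simp

lemma cinner_minus_left: "cinner (- x) (y::'a::chilbert_space) = - cinner x y"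
  using cinner_scaleC_left[of "-1" x y] by simp

lemma cinner_diff_right: "cinner x (y - z::'a::chilbert_space) = cinner x y - cinner x z"
  by (metis add_uminus_conv_diff cinner_add_right cinner_minus_right)

lemma cinner_diff_left: "cinner (x - y) (z::'a::chilbert_space) = cinner x z - cinner y z"
  by (metis add_uminus_conv_diff cinner_add_left cinner_minus_left)

lemma cinner_zero_right [simp]: "cinner x (0::'a::chilbert_space) = 0"
  using cinner_diff_right[of x x x] by simp

lemma cinner_self_eq_0: "cinner x x = 0 \<Longrightarrow> x = (0::'a::chilbert_space)"
  by (metis inner_cinner inner_eq_zero_iff zero_complex.sel(1))

lemma norm_scaleC: "norm (c *\<^sub>C x) = cmod c * norm (x::'a::chilbert_space)"
proof -
  have "cinner (c *\<^sub>C x) (c *\<^sub>C x) = (cnj c * c) * cinner x x"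
    by (simp add: cinner_scaleC_left cinner_scaleC_right)
  also have "cnj c * c = complex_of_real ((cmod c)\<^sup>2)"
    by (metis complex_norm_square mult.commute)
  finally have "inner (c *\<^sub>C x) (c *\<^sub>C x) = (cmod c)\<^sup>2 * inner x x"
    by (simp add: inner_cinner)
  then show ?thesis
    by (simp add: norm_eq_sqrt_inner real_sqrt_mult)
qed

lemma bounded_linear_scaleC: "bounded_linear (\<lambda>x::'a::chilbert_space. c *\<^sub>C x)"
  by (rule bounded_linear_intro[where K="cmod c"])
    (auto simp: scaleC_add_right norm_scaleC scaleR_scaleC scaleC_scaleC mult.commute)

lemma csubspace_scaleR: "cvs.subspace S \<Longrightarrow> x \<in> S \<Longrightarrow> r *\<^sub>R x \<in> S"
  by (simp add: scaleR_scaleC cvs.subspace_scale)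

lemma csubspace_closure: "cvs.subspace S \<Longrightarrow> cvs.subspace (closure S)"
proof (rule cvs.subspaceI)
  assume S: "cvs.subspace S"
  show "0 \<in> closure S"
    using S closure_subset cvs.subspace_0 by blast
  fix x y assume x: "x \<in> closure S" and y: "y \<in> closure S"
  obtain f g where f: "\<And>n. f n \<in> S" "f \<longlonglongrightarrow> x" and g: "\<And>n. g n \<in> S" "g \<longlonglongrightarrow> y"
    using x y unfolding closure_sequential by blast
  have "(\<lambda>n. f n + g n) \<longlonglongrightarrow> x + y"
    by (intro tendsto_add f g)
  then show "x + y \<in> closure S"
    unfolding closure_sequential using cvs.subspace_add[OF S] f g
    by (intro exI[of _ "\<lambda>n. f n + g n"]) auto
next
  fix c x assume S: "cvs.subspace S" and x: "x \<in> closure S"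
  obtain f where f: "\<And>n. f n \<in> S" "f \<longlonglongrightarrow> x"
    using x unfolding closure_sequential by blast
  have "(\<lambda>n. c *\<^sub>C f n) \<longlonglongrightarrow> c *\<^sub>C x"
    by (intro bounded_linear.tendsto[OF bounded_linear_scaleC] f)
  then show "c *\<^sub>C x \<in> closure S"
    unfolding closure_sequential using cvs.subspace_scale[OF S] f
    by (intro exI[of _ "\<lambda>n. c *\<^sub>C f n"]) auto
qed


section \<open>Orthogonal projections\<close>

definition is_projection :: "('h::chilbert_space \<Rightarrow> 'h) \<Rightarrow> bool" where
  "is_projection P \<longleftrightarrow> bounded_linear P \<and> (\<forall>c x. P (c *\<^sub>C x) = c *\<^sub>C P x) \<and>
     (\<forall>x. P (P x) = P x) \<and> (\<forall>x y. cinner (P x) y = cinner x (P y))"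

typedef (overloaded) 'h proj = "{P :: 'h::chilbert_space \<Rightarrow> 'h. is_projection P}"
  morphisms papply Abs_proj
  by (rule exI[of _ "\<lambda>x. x"]) (auto simp: is_projection_def)

setup_lifting type_definition_proj

abbreviation prange :: "'h::chilbert_space proj \<Rightarrow> 'h set" where
  "prange P \<equiv> range (papply P)"

lemma is_projection_papply: "is_projection (papply P)"
  using papply by auto

lemma papply_bounded_linear: "bounded_linear (papply P)"
  using is_projection_papply[of P] unfolding is_projection_def by blast

lemma papply_scaleC: "papply P (c *\<^sub>C x) = c *\<^sub>C papply P x"
  using is_projection_papply[of P] unfolding is_projection_def by blast

lemma papply_idem: "papply P (papply P x) = papply P x"
  using is_projection_papply[of P] unfolding is_projection_def by blast

lemma papply_selfadjoint: "cinner (papply P x) y = cinner x (papply P y)"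
  using is_projection_papply[of P] unfolding is_projection_def by blast

lemma prange_iff: "x \<in> prange P \<longleftrightarrow> papply P x = x"
proof
  assume "papply P x = x"
  then show "x \<in> prange P"
    using rangeI[of "papply P" x] by simp
qed (auto simp: papply_idem)

lemma csubspace_prange: "cvs.subspace (prange P)"
proof -
  interpret bounded_linear "papply P"
    by (rule papply_bounded_linear)
  show ?thesis
    unfolding cvs.subspace_def prange_iff by (auto simp: zero add papply_scaleC papply_idem)
qed

lemma closed_prange: "closed (prange P)"
proof -
  have "closed {x. papply P x = x}"
    by (intro closed_Collect_eq continuous_intros
        linear_continuous_on[OF papply_bounded_linear])
  then show ?thesis
    by (simp add: prange_iff[symmetric])
qed

lemma prange_inject: "prange P = prange R \<Longrightarrow> P = R"
proof -
  assume eq: "prange P = prange R"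
  have "papply P x = papply R x" for x
  proof -
    let ?p = "papply P x" and ?r = "papply R x"
    have PR: "papply P ?r = ?r" and RP: "papply R ?p = ?p"
      using eq by (metis prange_iff rangeI)+
    have "papply P (?p - ?r) = ?p - ?r" "papply R (?p - ?r) = ?p - ?r"
      using papply_bounded_linear[of P] papply_bounded_linear[of R] PR RP
      by (simp_all add: linear_simps papply_idem)
    then have "cinner (?p - ?r) ?p = cinner (?p - ?r) x" "cinner (?p - ?r) ?r = cinner (?p - ?r) x"
      by (metis papply_selfadjoint)+
    then have "cinner (?p - ?r) (?p - ?r) = 0"
      by (simp add: cinner_diff_right[of "?p - ?r" ?p ?r])
    then show ?thesis
      using cinner_self_eq_0 by fastforce
  qed
  then show "P = R"
    by (metis papply_inject ext)
qed

lemma closest_exists: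
  fixes S :: "'h::chilbert_space set"
  assumes S: "cvs.subspace S" and cl: "closed S"
  obtains y where "y \<in> S" "\<And>z. z \<in> S \<Longrightarrow> norm (x - y) \<le> norm (x - z)"
proof -
  define D where "D = (INF z\<in>S. (norm (x - z))\<^sup>2)"
  have ne: "S \<noteq> {}"
    using cvs.subspace_0[OF S] by auto
  have bdd: "bdd_below ((\<lambda>z. (norm (x - z))\<^sup>2) ` S)"
    by (rule bdd_belowI[of _ 0]) auto
  have D: "D \<le> (norm (x - z))\<^sup>2" if "z \<in> S" for z
    unfolding D_def by (rule cINF_lower[OF bdd that])
  define F where "F n = {y\<in>S. (norm (x - y))\<^sup>2 \<le> D + 1 / real (Suc n)}" for n
  have "closed (F n)" for n
  proof -
    have "F n = S \<inter> {y. (norm (x - y))\<^sup>2 \<le> D + 1 / real (Suc n)}"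
      by (auto simp: F_def)
    moreover have "closed {y. (norm (x - y))\<^sup>2 \<le> D + 1 / real (Suc n)}"
      by (intro closed_Collect_le continuous_intros)
    ultimately show ?thesis
      using cl by auto
  qed
  moreover have "F n \<noteq> {}" for n
  proof -
    have "D < D + 1 / real (Suc n)"
      by simp
    then have "\<exists>z\<in>S. (norm (x - z))\<^sup>2 < D + 1 / real (Suc n)"
      unfolding D_def using cINF_less_iff[OF ne bdd] by blast
    then show ?thesis
      by (force simp: F_def)
  qed
  moreover have "F n \<subseteq> F m" if "m \<le> n" for m n
  proof -
    have "1 / real (Suc n) \<le> 1 / real (Suc m)"
      using that by (intro divide_left_mono) auto
    then show ?thesis
      by (force simp: F_def)
  qed
  moreover have "\<exists>n. \<forall>y\<in>F n. \<forall>z\<in>F n. dist y z < e" if e: "e > 0" for e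
  proof -
    obtain n where n: "4 / e\<^sup>2 < real (Suc n)"
      by (meson less_Suc_eq of_nat_less_iff order_less_trans reals_Archimedean2)
    have small: "4 / real (Suc n) < e\<^sup>2"
      using n e by (simp add: field_simps)
    have "dist y z < e" if y: "y \<in> F n" and z: "z \<in> F n" for y z
    proof -
      have "(1/2) *\<^sub>R (y + z) \<in> S"
        using y z S by (auto simp: F_def intro!: csubspace_scaleR cvs.subspace_add)
      then have "D \<le> (norm (x - (1/2) *\<^sub>R (y + z)))\<^sup>2"
        by (rule D)
      moreover have "(norm (y - z))\<^sup>2 = 2 * (norm (x - y))\<^sup>2 + 2 * (norm (x - z))\<^sup>2
          - 4 * (norm (x - (1/2) *\<^sub>R (y + z)))\<^sup>2"
        unfolding power2_norm_eq_inner
        by (simp add: inner_diff_left inner_diff_right inner_add_left inner_add_right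
            inner_commute algebra_simps)
      ultimately have "(norm (y - z))\<^sup>2 \<le> 4 / real (Suc n)"
        using y z by (simp add: F_def)
      with small have "(norm (y - z))\<^sup>2 < e\<^sup>2"
        by linarith
      then show ?thesis
        using e by (simp add: dist_norm power2_less_imp_less)
    qed
    then show ?thesis
      by blast
  qed
  ultimately obtain y where y: "\<And>n. y \<in> F n"
    using decreasing_closed_nest[of F] by blast
  have "(norm (x - y))\<^sup>2 \<le> D"
  proof (rule field_le_epsilon)
    fix e :: real assume "e > 0"
    then obtain n where "inverse (real (Suc n)) < e"
      using reals_Archimedean by blast
    then show "(norm (x - y))\<^sup>2 \<le> D + e"
      using y[of n] by (auto simp: F_def inverse_eq_divide)
  qed
  then have "norm (x - y) \<le> norm (x - z)" if "z \<in> S" for z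
    using D[OF that] by (meson norm_ge_zero order_trans power2_le_imp_le)
  then show thesis
    using that y by (auto simp: F_def)
qed

lemma orthogonal_decomposition:
  fixes S :: "'h::chilbert_space set"
  assumes S: "cvs.subspace S" and cl: "closed S"
  obtains y where "y \<in> S" "\<And>s. s \<in> S \<Longrightarrow> cinner s (x - y) = 0"
proof -
  obtain y where y: "y \<in> S" "\<And>z. z \<in> S \<Longrightarrow> norm (x - y) \<le> norm (x - z)"
    using closest_exists[OF S cl] by metis
  have re: "inner s (x - y) = 0" if s: "s \<in> S" for s
  proof (cases "s = 0")
    case False
    define t where "t = inner s (x - y) / inner s s"
    have "y + t *\<^sub>R s \<in> S"
      using y s S by (auto intro!: csubspace_scaleR cvs.subspace_add)
    then have "norm (x - y) \<le> norm (x - (y + t *\<^sub>R s))"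
      by (rule y)
    then have "(norm (x - y))\<^sup>2 \<le> (norm (x - y - t *\<^sub>R s))\<^sup>2"
      by (simp add: diff_diff_eq power_mono)
    also have "\<dots> = (norm (x - y))\<^sup>2 - 2 * t * inner s (x - y) + t * t * inner s s"
      unfolding power2_norm_eq_inner
      by (simp add: inner_diff_left[of "x - y"] inner_diff_right[of _ "x - y"]
          inner_commute[of "x - y" s] right_diff_distrib mult.assoc)
    also have "t * t * inner s s = t * inner s (x - y)"
      using False by (simp add: t_def)
    finally have "t * inner s (x - y) \<le> 0"
      by simp
    then have "(inner s (x - y))\<^sup>2 / inner s s \<le> 0"
      by (simp add: t_def power2_eq_square)
    then show ?thesis
      using False by (simp add: divide_le_0_iff not_le)
        (metis inner_ge_zero inner_eq_zero_iff order_antisym)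
  qed simp
  have "cinner s (x - y) = 0" if s: "s \<in> S" for s
  proof -
    have "Re (cinner s (x - y)) = 0"
      using re[OF s] by (simp add: inner_cinner)
    moreover have "Re (cinner (\<i> *\<^sub>C s) (x - y)) = 0"
      using re[OF cvs.subspace_scale[OF S s]] by (simp add: inner_cinner)
    ultimately show ?thesis
      by (simp add: cinner_scaleC_left complex_eq_iff)
  qed
  then show thesis
    using that y by blast
qed

lemma projection_exists:
  fixes S :: "'h::chilbert_space set"
  assumes S: "cvs.subspace S" and cl: "closed S"
  shows "\<exists>P. prange P = S"
proof -
  have "\<exists>y. y \<in> S \<and> (\<forall>s\<in>S. cinner s (x - y) = 0)" for x
    using orthogonal_decomposition[OF S cl] by metis
  then obtain f where f: "\<And>x. f x \<in> S" "\<And>x s. s \<in> S \<Longrightarrow> cinner s (x - f x) = 0"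
    by metis
  have uniq: "f x = y" if y: "y \<in> S" "\<And>s. s \<in> S \<Longrightarrow> cinner s (x - y) = 0" for x y
  proof -
    have d: "f x - y \<in> S"
      using f y S cvs.subspace_diff by blast
    have "cinner (f x - y) (f x - y) = cinner (f x - y) (x - y) - cinner (f x - y) (x - f x)"
      by (simp add: cinner_diff_right)
    then have "cinner (f x - y) (f x - y) = 0"
      using y(2)[OF d] f(2)[OF d] by simp
    then show ?thesis
      using cinner_self_eq_0 by fastforce
  qed
  have add: "f (x + y) = f x + f y" for x y
  proof (rule uniq)
    show "cinner s (x + y - (f x + f y)) = 0" if "s \<in> S" for s
      using f(2)[OF that, of x] f(2)[OF that, of y]
      by (simp add: cinner_diff_right cinner_add_right)
  qed (use S f cvs.subspace_add in blast)
  have scale: "f (c *\<^sub>C x) = c *\<^sub>C f x" for c x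
  proof (rule uniq)
    show "cinner s (c *\<^sub>C x - c *\<^sub>C f x) = 0" if "s \<in> S" for s
      using f(2)[OF that, of x] by (simp add: cinner_diff_right cinner_scaleC_right)
  qed (use S f cvs.subspace_scale in blast)
  have idem: "f x = x" if "x \<in> S" for x
    by (rule uniq) (use that in \<open>simp_all add: cinner_diff_right\<close>)
  have left: "cinner x (f y) = cinner (f x) (f y)" for x y
  proof -
    have "cinner (x - f x) (f y) = cnj (cinner (f y) (x - f x))"
      by (rule cinner_commute)
    then have "cinner (x - f x) (f y) = 0"
      using f by simp
    then show ?thesis
      by (simp add: cinner_diff_left)
  qed
  have adj: "cinner (f x) y = cinner x (f y)" for x y
  proof -
    have "cinner (f x) y = cnj (cinner y (f x))"
      by (rule cinner_commute)
    also have "\<dots> = cnj (cinner (f y) (f x))"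
      by (subst left) (rule refl)
    also have "\<dots> = cinner (f x) (f y)"
      by (rule cinner_commute[symmetric])
    also have "\<dots> = cinner x (f y)"
      by (rule left[symmetric])
    finally show ?thesis .
  qed
  have bd: "norm (f x) \<le> norm x * 1" for x
  proof -
    have "inner (f x) (f x) = inner x (f x)"
      unfolding inner_cinner by (subst left[of x x]) (rule refl)
    also have "\<dots> \<le> norm x * norm (f x)"
      by (rule norm_cauchy_schwarz)
    finally have "norm (f x) * norm (f x) \<le> norm x * norm (f x)"
      by (simp add: power2_norm_eq_inner[symmetric] power2_eq_square)
    then show ?thesis
      by (cases "f x = 0") auto
  qed
  have "bounded_linear f"
    by (rule bounded_linear_intro[where K=1]) (simp_all only: add scale bd scaleR_scaleC)
  then have "is_projection f"
    unfolding is_projection_def using scale idem[OF f(1)] adj by blast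
  then have "papply (Abs_proj f) = f"
    by (simp add: Abs_proj_inverse)
  moreover have "range f = S"
  proof
    show "S \<subseteq> range f"
      by (metis idem rangeI subsetI)
  qed (use f in auto)
  ultimately show ?thesis
    by metis
qed

definition proj_on :: "'h::chilbert_space set \<Rightarrow> 'h proj" where
  "proj_on S = (THE P. prange P = S)"

lemma prange_proj_on: "cvs.subspace S \<Longrightarrow> closed S \<Longrightarrow> prange (proj_on S) = S"
  unfolding proj_on_def using projection_exists prange_inject by (metis (mono_tags, lifting) theI)

instantiation proj :: (chilbert_space) complete_lattice
begin

definition less_eq_proj :: "'a proj \<Rightarrow> 'a proj \<Rightarrow> bool" where
  "P \<le> R \<longleftrightarrow> prange P \<subseteq> prange R"
definition less_proj :: "'a proj \<Rightarrow> 'a proj \<Rightarrow> bool" where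
  "P < R \<longleftrightarrow> prange P \<subset> prange R"
definition Inf_proj :: "'a proj set \<Rightarrow> 'a proj" where
  "Inf A = proj_on (\<Inter>P\<in>A. prange P)"
definition Sup_proj :: "'a proj set \<Rightarrow> 'a proj" where
  "Sup A = proj_on (closure (cvs.span (\<Union>P\<in>A. prange P)))"
definition inf_proj :: "'a proj \<Rightarrow> 'a proj \<Rightarrow> 'a proj" where
  "inf P R = Inf {P, R :: 'a proj}"
definition sup_proj :: "'a proj \<Rightarrow> 'a proj \<Rightarrow> 'a proj" where
  "sup P R = Sup {P, R :: 'a proj}"
definition top_proj :: "'a proj" where
  "top = (Inf {} :: 'a proj)"
definition bot_proj :: "'a proj" where
  "bot = (Sup {} :: 'a proj)"

lemma prange_Inf: "prange (Inf A) = (\<Inter>P\<in>A. prange (P::'a proj))"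
  unfolding Inf_proj_def
  by (rule prange_proj_on) (auto intro!: closed_prange cvs.subspace_Inter csubspace_prange)

lemma prange_Sup: "prange (Sup A) = closure (cvs.span (\<Union>P\<in>A. prange (P::'a proj)))"
  unfolding Sup_proj_def
  by (rule prange_proj_on) (auto intro!: csubspace_closure)

lemma proj_Inf_lower: "P \<in> A \<Longrightarrow> Inf A \<le> (P::'a proj)"
  unfolding less_eq_proj_def prange_Inf by blast

lemma proj_Inf_greatest: "(\<And>R. R \<in> A \<Longrightarrow> P \<le> R) \<Longrightarrow> P \<le> Inf (A::'a proj set)"
  unfolding less_eq_proj_def prange_Inf by blast

lemma proj_Sup_upper: "P \<in> A \<Longrightarrow> (P::'a proj) \<le> Sup A"
  unfolding less_eq_proj_def prange_Sup
  by (rule subset_trans[OF _ closure_subset], rule subset_trans[OF _ cvs.span_superset]) blast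

lemma proj_Sup_least: "(\<And>R. R \<in> A \<Longrightarrow> R \<le> P) \<Longrightarrow> Sup A \<le> (P::'a proj)"
  unfolding less_eq_proj_def prange_Sup
  by (intro closure_minimal cvs.span_minimal closed_prange csubspace_prange) blast

instance
proof
  fix P R T :: "'a proj" and A :: "'a proj set"
  show "P < R \<longleftrightarrow> P \<le> R \<and> \<not> R \<le> P" "P \<le> P"
    by (auto simp: less_eq_proj_def less_proj_def)
  show "P \<le> R \<Longrightarrow> R \<le> T \<Longrightarrow> P \<le> T"
    unfolding less_eq_proj_def by (rule subset_trans)
  show "P \<le> R \<Longrightarrow> R \<le> P \<Longrightarrow> P = R"
    unfolding less_eq_proj_def by (intro prange_inject subset_antisym)
  show "inf P R \<le> P" "inf P R \<le> R" "P \<le> sup P R" "R \<le> sup P R"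
    by (auto simp: inf_proj_def sup_proj_def intro: proj_Inf_lower proj_Sup_upper)
  show "P \<le> R \<Longrightarrow> P \<le> T \<Longrightarrow> P \<le> inf R T"
    unfolding inf_proj_def by (rule proj_Inf_greatest) auto
  show "R \<le> P \<Longrightarrow> T \<le> P \<Longrightarrow> sup R T \<le> P"
    unfolding sup_proj_def by (rule proj_Sup_least) auto
qed (simp_all add: top_proj_def bot_proj_def proj_Inf_lower proj_Inf_greatest
    proj_Sup_upper proj_Sup_least)

end

instantiation proj :: (chilbert_space) uminus
begin

lift_definition uminus_proj :: "'a proj \<Rightarrow> 'a proj" is "\<lambda>P x. x - P x"
  by (auto simp: is_projection_def linear_simps cinner_diff_left cinner_diff_right
      cvs.scale_right_diff_distrib intro!: bounded_linear_sub bounded_linear_ident)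

instance ..

end


section \<open>Logics\<close>

definition commutant :: "'h::chilbert_space proj set \<Rightarrow> 'h proj set" where
  "commutant A = {P. \<forall>R\<in>A. papply P \<circ> papply R = papply R \<circ> papply P}"

definition logic :: "'h::chilbert_space proj set \<Rightarrow> bool" where
  "logic Q \<longleftrightarrow> commutant (commutant Q) = Q"

lemma logic_UNIV: "logic (UNIV :: 'h::chilbert_space proj set)"
  unfolding logic_def commutant_def by auto

text \<open>
  The lattice operations of a logic \<open>Q\<close> are those of the poset \<open>Q\<close>, so infima and suprema are
  taken among the elements of \<open>Q\<close> only. For \<open>Q = UNIV\<close> they are the operations of the lattice of
  all projections.
\<close>

definition glb_in :: "'p::order set \<Rightarrow> 'p set \<Rightarrow> 'p" where
  "glb_in Q A = (THE m. m \<in> Q \<and> (\<forall>a\<in>A. m \<le> a) \<and> (\<forall>b\<in>Q. (\<forall>a\<in>A. b \<le> a) \<longrightarrow> b \<le> m))"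

definition lub_in :: "'p::order set \<Rightarrow> 'p set \<Rightarrow> 'p" where
  "lub_in Q A = (THE m. m \<in> Q \<and> (\<forall>a\<in>A. a \<le> m) \<and> (\<forall>b\<in>Q. (\<forall>a\<in>A. a \<le> b) \<longrightarrow> m \<le> b))"

lemma glb_in_UNIV: "glb_in UNIV A = Inf (A :: 'p::complete_lattice set)"
  unfolding glb_in_def
  by (rule the_equality) (auto intro: Inf_lower Inf_greatest antisym)

lemma lub_in_UNIV: "lub_in UNIV A = Sup (A :: 'p::complete_lattice set)"
  unfolding lub_in_def
  by (rule the_equality) (auto intro: Sup_upper Sup_least antisym)

definition meet_in :: "'p::order set \<Rightarrow> 'p \<Rightarrow> 'p \<Rightarrow> 'p" where
  "meet_in Q p q = glb_in Q {p, q}"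

definition join_in :: "'p::order set \<Rightarrow> 'p \<Rightarrow> 'p \<Rightarrow> 'p" where
  "join_in Q p q = lub_in Q {p, q}"

definition imp_in :: "'p::{order,uminus} set \<Rightarrow> 'p \<Rightarrow> 'p \<Rightarrow> 'p" where
  "imp_in Q p q = join_in Q (- p) (meet_in Q p q)"

definition iff_in :: "'p::{order,uminus} set \<Rightarrow> 'p \<Rightarrow> 'p \<Rightarrow> 'p" where
  "iff_in Q p q = meet_in Q (imp_in Q p q) (imp_in Q q p)"


section \<open>The universe of valued sets\<close>

text \<open>
  The elements of the type \<open>('i, 'p) vset\<close> constructed here are hereditarily functions: each
  \<open>u\<close> is determined by the partial function \<open>vfun u\<close> from \<open>('i, 'p) vset\<close> to \<open>'p\<close>
  (\<open>vfun_inject\<close>), every partial function whose domain has at most the cardinality of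
  the type \<open>'i\<close> occurs as some \<open>vfun u\<close> (\<open>vfun_surj\<close>), and the relation \<open>x \<in> dom (vfun u)\<close>
  is well-founded (\<open>wf_vfun\<close>). The index type \<open>'i\<close> only serves to bound the
  size of domains, without which there is no such type in HOL. It is arbitrary, so every
  hereditarily set-sized function is an element for a suitable choice of \<open>'i\<close>.

  The construction is the quotient of trees by extensional equality, restricted to
  those trees in which the label of a child depends only on its equivalence class, hereditarily.
\<close>

datatype ('i, 'p) tree = Tree (branches: "'i \<Rightarrow> (('i, 'p) tree \<times> 'p) option")

inductive tree_eq :: "('i, 'p) tree \<Rightarrow> ('i, 'p) tree \<Rightarrow> bool" where
  "(\<And>s p. (s, p) \<in> ran f \<Longrightarrow> \<exists>t. (t, p) \<in> ran g \<and> tree_eq s t) \<Longrightarrow>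
   (\<And>t p. (t, p) \<in> ran g \<Longrightarrow> \<exists>s. (s, p) \<in> ran f \<and> tree_eq s t) \<Longrightarrow>
   tree_eq (Tree f) (Tree g)"

inductive hfun :: "('i, 'p) tree \<Rightarrow> bool" where
  "(\<And>s p. (s, p) \<in> ran f \<Longrightarrow> hfun s) \<Longrightarrow>
   (\<And>s p t q. (s, p) \<in> ran f \<Longrightarrow> (t, q) \<in> ran f \<Longrightarrow> tree_eq s t \<Longrightarrow> p = q) \<Longrightarrow>
   hfun (Tree f)"

lemma tree_induct:
  assumes step: "\<And>f. (\<And>s p. (s, p) \<in> ran f \<Longrightarrow> P s) \<Longrightarrow> P (Tree f)"
  shows "P t"
proof (induction t)
  case (Tree f)
  show ?case
  proof (rule step)
    fix s p assume "(s, p) \<in> ran f"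
    then obtain i where "f i = Some (s, p)"
      by (auto simp: ran_def)
    then show "P s"
      using Tree.IH[of "Some (s, p)" "(s, p)" s] by (metis fsts.intros fst_conv option.set_intros rangeI)
  qed
qed

lemma tree_eq_Tree:
  "tree_eq (Tree f) (Tree g) \<longleftrightarrow>
    (\<forall>s p. (s, p) \<in> ran f \<longrightarrow> (\<exists>t. (t, p) \<in> ran g \<and> tree_eq s t)) \<and>
    (\<forall>t p. (t, p) \<in> ran g \<longrightarrow> (\<exists>s. (s, p) \<in> ran f \<and> tree_eq s t))"
  by (subst tree_eq.simps) auto

lemma hfun_Tree:
  "hfun (Tree f) \<longleftrightarrow> (\<forall>s p. (s, p) \<in> ran f \<longrightarrow> hfun s) \<and>
    (\<forall>s p t q. (s, p) \<in> ran f \<longrightarrow> (t, q) \<in> ran f \<longrightarrow> tree_eq s t \<longrightarrow> p = q)"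
  by (subst hfun.simps) auto

lemma hfun_child: "hfun (Tree f) \<Longrightarrow> (s, p) \<in> ran f \<Longrightarrow> hfun s"
  unfolding hfun_Tree by blast

lemma hfun_unique:
  "hfun (Tree f) \<Longrightarrow> (s, p) \<in> ran f \<Longrightarrow> (t, q) \<in> ran f \<Longrightarrow> tree_eq s t \<Longrightarrow> p = q"
  unfolding hfun_Tree by blast

lemma tree_eq_refl: "tree_eq t t"
  by (induction t rule: tree_induct) (auto simp: tree_eq_Tree)

lemma tree_eq_sym: "tree_eq s t \<Longrightarrow> tree_eq t s"
  by (induction rule: tree_eq.induct) (simp add: tree_eq_Tree, meson)

lemma tree_eq_trans: "tree_eq s t \<Longrightarrow> tree_eq t r \<Longrightarrow> tree_eq s r"
proof (induction arbitrary: r rule: tree_eq.induct)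
  case (1 f g)
  show ?case
  proof (cases r)
    case (Tree h)
    then show ?thesis
      using 1 unfolding Tree tree_eq_Tree by meson
  qed
qed

quotient_type ('i, 'p) vset = "('i, 'p) tree" / partial: "\<lambda>s t. hfun s \<and> hfun t \<and> tree_eq s t"
proof (rule part_equivpI)
  show "\<exists>t :: ('i, 'p) tree. hfun t \<and> hfun t \<and> tree_eq t t"
    by (rule exI[of _ "Tree (\<lambda>_. None)"]) (simp add: hfun_Tree tree_eq_refl)
qed (auto intro!: sympI transpI intro: tree_eq_sym tree_eq_trans)

definition vgraph :: "('i, 'p) vset \<Rightarrow> (('i, 'p) vset \<times> 'p) set" where
  "vgraph u = {(abs_vset s, p) | s p. (s, p) \<in> ran (branches (rep_vset u))}"

definition vfun :: "('i, 'p) vset \<Rightarrow> (('i, 'p) vset \<rightharpoonup> 'p)" where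
  "vfun u x = (if \<exists>p. (x, p) \<in> vgraph u then Some (THE p. (x, p) \<in> vgraph u) else None)"

lemma abs_vset_eq_iff: "hfun s \<Longrightarrow> hfun t \<Longrightarrow> abs_vset s = abs_vset t \<longleftrightarrow> tree_eq s t"
  using Quotient3_rel[OF Quotient3_vset, of s t] by (simp add: tree_eq_refl)

lemma hfun_rep_vset: "hfun (rep_vset u)"
  using Quotient3_rep_reflp[OF Quotient3_vset, of u] by simp

lemma abs_rep_vset: "abs_vset (rep_vset u) = u"
  by (rule Quotient3_abs_rep[OF Quotient3_vset])

lemma vset_cases:
  obtains f where "u = abs_vset (Tree f)" "hfun (Tree f)"
  by (metis abs_rep_vset hfun_rep_vset tree.exhaust)

lemma tree_eq_children:
  assumes f: "hfun (Tree f)" and g: "hfun (Tree g)" and eq: "tree_eq (Tree f) (Tree g)"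
  shows "(\<exists>s. (s, p) \<in> ran f \<and> abs_vset s = x) \<longleftrightarrow> (\<exists>s. (s, p) \<in> ran g \<and> abs_vset s = x)"
proof
  assume "\<exists>s. (s, p) \<in> ran f \<and> abs_vset s = x"
  then obtain s where s: "(s, p) \<in> ran f" "abs_vset s = x"
    by blast
  then obtain t where t: "(t, p) \<in> ran g" "tree_eq s t"
    using eq unfolding tree_eq_Tree by blast
  have "abs_vset t = x"
    using s t abs_vset_eq_iff[OF hfun_child[OF f s(1)] hfun_child[OF g t(1)]] by simp
  with t show "\<exists>s. (s, p) \<in> ran g \<and> abs_vset s = x"
    by blast
next
  assume "\<exists>s. (s, p) \<in> ran g \<and> abs_vset s = x"
  then obtain t where t: "(t, p) \<in> ran g" "abs_vset t = x"
    by blast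
  then obtain s where s: "(s, p) \<in> ran f" "tree_eq s t"
    using eq unfolding tree_eq_Tree by blast
  have "abs_vset s = x"
    using s t abs_vset_eq_iff[OF hfun_child[OF f s(1)] hfun_child[OF g t(1)]] by simp
  with s show "\<exists>s. (s, p) \<in> ran f \<and> abs_vset s = x"
    by blast
qed

lemma vfun_abs:
  assumes f: "hfun (Tree f)"
  shows "vfun (abs_vset (Tree f)) x = Some p \<longleftrightarrow> (\<exists>s. (s, p) \<in> ran f \<and> abs_vset s = x)"
proof -
  obtain g where g: "rep_vset (abs_vset (Tree f)) = Tree g"
    by (rule tree.exhaust)
  have hg: "hfun (Tree g)"
    by (metis g hfun_rep_vset)
  have eq: "tree_eq (Tree g) (Tree f)"
    using abs_vset_eq_iff[OF hg f] by (metis g abs_rep_vset)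
  have graph: "(y, q) \<in> vgraph (abs_vset (Tree f)) \<longleftrightarrow> (\<exists>s. (s, q) \<in> ran f \<and> abs_vset s = y)" for y q
  proof -
    have "(y, q) \<in> vgraph (abs_vset (Tree f)) \<longleftrightarrow> (\<exists>s. (s, q) \<in> ran g \<and> abs_vset s = y)"
      by (auto simp: vgraph_def g)
    also have "\<dots> \<longleftrightarrow> (\<exists>s. (s, q) \<in> ran f \<and> abs_vset s = y)"
      by (rule tree_eq_children[OF hg f eq])
    finally show ?thesis .
  qed
  have uniq: "p = q" if "(y, p) \<in> vgraph (abs_vset (Tree f))" "(y, q) \<in> vgraph (abs_vset (Tree f))"
    for y p q
  proof -
    from that(1) obtain s where s: "(s, p) \<in> ran f" "abs_vset s = y"
      unfolding graph by (elim exE conjE)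
    from that(2) obtain t where t: "(t, q) \<in> ran f" "abs_vset t = y"
      unfolding graph by (elim exE conjE)
    have "tree_eq s t"
      using s t abs_vset_eq_iff[OF hfun_child[OF f s(1)] hfun_child[OF f t(1)]] by simp
    then show ?thesis
      by (rule hfun_unique[OF f s(1) t(1)])
  qed
  have "vfun (abs_vset (Tree f)) x = Some p \<longleftrightarrow> (x, p) \<in> vgraph (abs_vset (Tree f))"
  proof
    assume "vfun (abs_vset (Tree f)) x = Some p"
    then obtain q where q: "(x, q) \<in> vgraph (abs_vset (Tree f))"
      and p: "(THE p. (x, p) \<in> vgraph (abs_vset (Tree f))) = p"
      unfolding vfun_def by (meson option.distinct(1) option.inject)
    from q have "(THE p. (x, p) \<in> vgraph (abs_vset (Tree f))) = q"
      by (rule the_equality) (rule uniq[OF _ q])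
    with p q show "(x, p) \<in> vgraph (abs_vset (Tree f))"
      by simp
  next
    assume p: "(x, p) \<in> vgraph (abs_vset (Tree f))"
    then have "(THE p. (x, p) \<in> vgraph (abs_vset (Tree f))) = p"
      by (rule the_equality) (rule uniq[OF _ p])
    with p show "vfun (abs_vset (Tree f)) x = Some p"
      unfolding vfun_def by (simp only: if_P exI[of _ p])
  qed
  then show ?thesis
    by (simp add: graph)
qed

lemma vfun_inject:
  assumes "vfun u = vfun v"
  shows "u = v"
proof -
  obtain f g where f: "u = abs_vset (Tree f)" "hfun (Tree f)" and g: "v = abs_vset (Tree g)" "hfun (Tree g)"
    using vset_cases[of u] vset_cases[of v] by metis
  have "(\<exists>s. (s, p) \<in> ran f \<and> abs_vset s = x) \<longleftrightarrow> (\<exists>s. (s, p) \<in> ran g \<and> abs_vset s = x)" for x p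
    using assms vfun_abs[OF f(2), of x p] vfun_abs[OF g(2), of x p] by (simp add: f(1) g(1))
  note * = this
  have "tree_eq (Tree f) (Tree g)"
    unfolding tree_eq_Tree
  proof (intro conjI allI impI)
    fix s p assume s: "(s, p) \<in> ran f"
    then obtain t where t: "(t, p) \<in> ran g" "abs_vset t = abs_vset s"
      using * by blast
    then show "\<exists>t. (t, p) \<in> ran g \<and> tree_eq s t"
      using abs_vset_eq_iff[OF hfun_child[OF f(2) s] hfun_child[OF g(2) t(1)]] by auto
  next
    fix t p assume t: "(t, p) \<in> ran g"
    then obtain s where s: "(s, p) \<in> ran f" "abs_vset s = abs_vset t"
      using * by blast
    then show "\<exists>s. (s, p) \<in> ran f \<and> tree_eq s t"
      using abs_vset_eq_iff[OF hfun_child[OF f(2) s(1)] hfun_child[OF g(2) t]] by auto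
  qed
  then show ?thesis
    using abs_vset_eq_iff f g by blast
qed

lemma vfun_bound:
  includes cardinal_syntax
  shows "|dom (vfun (u :: ('i, 'p) vset))| \<le>o |UNIV :: 'i set|"
proof -
  obtain f where f: "u = abs_vset (Tree f)" "hfun (Tree f)"
    by (rule vset_cases)
  have "dom (vfun u) \<subseteq> (\<lambda>i. abs_vset (fst (the (f i)))) ` UNIV"
    unfolding f(1) by (auto simp: vfun_abs[OF f(2)] ran_def image_iff) (metis fst_conv option.sel)
  then show ?thesis
    by (rule surj_imp_ordLeq)
qed

lemma vfun_surj:
  includes cardinal_syntax
  fixes F :: "('i, 'p) vset \<rightharpoonup> 'p"
  assumes "|dom F| \<le>o |UNIV :: 'i set|"
  shows "\<exists>u. vfun u = F"
proof -
  obtain e :: "('i, 'p) vset \<Rightarrow> 'i" where e: "inj_on e (dom F)"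
    using assms unfolding card_of_ordLeq[symmetric] by (elim exE conjE)
  define f where "f i = (if i \<in> e ` dom F
    then (let x = inv_into (dom F) e i in Some (rep_vset x, the (F x))) else None)" for i
  have ran: "ran f = {(rep_vset x, p) | x p. F x = Some p}"
  proof (intro set_eqI iffI)
    fix y assume "y \<in> ran f"
    then obtain i where i: "f i = Some y"
      unfolding ran_def by blast
    then have "i \<in> e ` dom F"
      unfolding f_def by (meson option.distinct(1))
    then obtain x p where "i = e x" "F x = Some p"
      by blast
    moreover from this have "inv_into (dom F) e i = x"
      using e by (simp add: inv_into_f_f domI)
    ultimately have "y = (rep_vset x, p)"
      using i \<open>i \<in> e ` dom F\<close> by (simp add: f_def)
    with \<open>F x = Some p\<close> show "y \<in> {(rep_vset x, p) | x p. F x = Some p}"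
      by blast
  next
    fix y assume "y \<in> {(rep_vset x, p) | x p. F x = Some p}"
    then obtain x p where y: "y = (rep_vset x, p)" "F x = Some p"
      by blast
    then have "x \<in> dom F"
      by blast
    with y e have "f (e x) = Some y"
      by (simp add: f_def)
    then show "y \<in> ran f"
      by (rule ranI)
  qed
  have hf: "hfun (Tree f)"
    unfolding hfun_Tree ran
  proof (intro conjI allI impI)
    fix s p t q
    assume "(s, p) \<in> {(rep_vset x, p) | x p. F x = Some p}"
      and "(t, q) \<in> {(rep_vset x, p) | x p. F x = Some p}" and st: "tree_eq s t"
    then obtain x y where x: "s = rep_vset x" "F x = Some p" and y: "t = rep_vset y" "F y = Some q"
      by blast
    have "x = y"
      using st abs_vset_eq_iff[OF hfun_rep_vset hfun_rep_vset, of x y]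
      by (simp add: x y abs_rep_vset)
    with x y show "p = q"
      by simp
  qed (auto simp: hfun_rep_vset)
  have "vfun (abs_vset (Tree f)) x = Some p \<longleftrightarrow> F x = Some p" for x p
    unfolding vfun_abs[OF hf] ran
  proof
    assume "F x = Some p"
    then show "\<exists>s. (s, p) \<in> {(rep_vset x, p) | x p. F x = Some p} \<and> abs_vset s = x"
      using abs_rep_vset by blast
  qed (auto simp: abs_rep_vset)
  note * = this
  have "vfun (abs_vset (Tree f)) x = F x" for x
  proof (cases "F x")
    case None
    then show ?thesis
      using *[of x "the (vfun (abs_vset (Tree f)) x)"] by (cases "vfun (abs_vset (Tree f)) x") simp_all
  next
    case (Some p)
    then show ?thesis
      using *[of x p] by simp
  qed
  then have "vfun (abs_vset (Tree f)) = F"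
    by (rule ext)
  then show ?thesis ..
qed

lemma wf_vfun: "wf {(x, u :: ('i, 'p) vset). x \<in> dom (vfun u)}"
proof (rule wfUNIVI)
  fix P :: "('i, 'p) vset \<Rightarrow> bool" and u
  assume step: "\<forall>u. (\<forall>x. (x, u) \<in> {(x, u). x \<in> dom (vfun u)} \<longrightarrow> P x) \<longrightarrow> P u"
  have "hfun t \<Longrightarrow> P (abs_vset t)" for t
  proof (induction t rule: tree_induct)
    case (1 f)
    show ?case
    proof (rule step[rule_format])
      fix x assume "(x, abs_vset (Tree f)) \<in> {(x, u). x \<in> dom (vfun u)}"
      then obtain s p where "(s, p) \<in> ran f" "abs_vset s = x"
        by (auto simp: dom_def vfun_abs[OF 1(2)])
      then show "P x"
        using 1(1) hfun_child[OF 1(2)] by blast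
    qed
  qed
  then show "P u"
    by (metis abs_rep_vset hfun_rep_vset)
qed

text \<open>
  \<open>V Q\<close> is the union of the cumulative hierarchy over \<open>Q\<close>, given as the least set
  containing every function with domain included in it and values in \<open>Q\<close>.
\<close>

inductive_set V :: "'p set \<Rightarrow> ('i, 'p) vset set" for Q :: "'p set" where
  "(\<And>x. x \<in> dom (vfun u) \<Longrightarrow> x \<in> V Q) \<Longrightarrow> ran (vfun u) \<subseteq> Q \<Longrightarrow> u \<in> V Q"

lemma V_UNIV: "V UNIV = UNIV"
proof -
  have "u \<in> V UNIV" for u :: "('i, 'p) vset"
    by (induction u rule: wf_induct_rule[OF wf_vfun]) (auto intro: V.intros)
  then show ?thesis
    by blast
qed


section \<open>Truth values\<close>

text \<open>\<open>veq Q u v\<close> and \<open>vmem Q u v\<close> are the \<open>Q\<close>-values of \<open>u = v\<close> and \<open>u \<in> v\<close>.\<close>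

function veq :: "'p::{order,uminus} set \<Rightarrow> ('i, 'p) vset \<Rightarrow> ('i, 'p) vset \<Rightarrow> 'p"
  and vmem :: "'p set \<Rightarrow> ('i, 'p) vset \<Rightarrow> ('i, 'p) vset \<Rightarrow> 'p"
where
  "veq Q u v = meet_in Q
     (glb_in Q ((\<lambda>u'. imp_in Q (the (vfun u u')) (vmem Q u' v)) ` dom (vfun u)))
     (glb_in Q ((\<lambda>v'. imp_in Q (the (vfun v v')) (vmem Q v' u)) ` dom (vfun v)))"
| "vmem Q u v = lub_in Q ((\<lambda>v'. meet_in Q (the (vfun v v')) (veq Q u v')) ` dom (vfun v))"
  by pat_completeness auto

termination
proof (relation "inv_image (mult1 {(x, u). x \<in> dom (vfun u)})
    (case_sum (\<lambda>(Q, u, v). {#u, v#}) (\<lambda>(Q, u, v). {#u, v#}))")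
  show "wf (inv_image (mult1 {(x, u :: ('i, 'p) vset). x \<in> dom (vfun u)})
      (case_sum (\<lambda>(Q :: 'p set, u, v). {#u, v#}) (\<lambda>(Q :: 'p set, u, v). {#u, v#})))"
    by (intro wf_inv_image wf_mult1 wf_vfun)
  have *: "({#x, v#}, {#u, v#}) \<in> mult1 {(x, u). x \<in> dom (vfun u)}"
    if "x \<in> dom (vfun u)" for x u v :: "('i, 'p) vset"
    unfolding mult1_def
    by (intro CollectI case_prodI exI[of _ u] exI[of _ "{#v#}"] exI[of _ "{#x#}"])
      (use that in \<open>auto simp: add_mset_commute\<close>)
  show "(Inr (Q, x, v), Inl (Q, u, v)) \<in> inv_image (mult1 {(x, u). x \<in> dom (vfun u)})
      (case_sum (\<lambda>(Q, u, v). {#u, v#}) (\<lambda>(Q, u, v). {#u, v#}))"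
    if "x \<in> dom (vfun u)" for Q :: "'p set" and u v x :: "('i, 'p) vset"
    using *[OF that] by simp
  show "(Inr (Q, x, u), Inl (Q, u, v)) \<in> inv_image (mult1 {(x, u). x \<in> dom (vfun u)})
      (case_sum (\<lambda>(Q, u, v). {#u, v#}) (\<lambda>(Q, u, v). {#u, v#}))"
    if "x \<in> dom (vfun v)" for Q :: "'p set" and u v x :: "('i, 'p) vset"
    using *[OF that, of u] by (simp add: add_mset_commute)
  show "(Inl (Q, u, x), Inr (Q, u, v)) \<in> inv_image (mult1 {(x, u). x \<in> dom (vfun u)})
      (case_sum (\<lambda>(Q, u, v). {#u, v#}) (\<lambda>(Q, u, v). {#u, v#}))"
    if "x \<in> dom (vfun v)" for Q :: "'p set" and u v x :: "('i, 'p) vset"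
    using *[OF that, of u] by (simp add: add_mset_commute)
qed

declare veq.simps [simp del] vmem.simps [simp del]

text \<open>
  Variables are natural numbers. In \<open>BAll x y \<phi>\<close> and \<open>BEx x y \<phi>\<close>, i.e. \<open>(\<forall>x \<in> y) \<phi>\<close> and
  \<open>(\<exists>x \<in> y) \<phi>\<close>, only the occurrences of \<open>x\<close> in \<open>\<phi>\<close> are bound, not the bounding variable \<open>y\<close>.
\<close>

datatype fm =
    Eq nat nat
  | Mem nat nat
  | Neg fm
  | And fm fm
  | Or fm fm
  | Imp fm fm
  | Iff fm fm
  | BAll nat nat fm
  | BEx nat nat fm
  | All nat fm
  | Ex nat fm

primrec fv :: "fm \<Rightarrow> nat set" where
  "fv (Eq x y) = {x, y}"
| "fv (Mem x y) = {x, y}"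
| "fv (Neg \<phi>) = fv \<phi>"
| "fv (And \<phi> \<psi>) = fv \<phi> \<union> fv \<psi>"
| "fv (Or \<phi> \<psi>) = fv \<phi> \<union> fv \<psi>"
| "fv (Imp \<phi> \<psi>) = fv \<phi> \<union> fv \<psi>"
| "fv (Iff \<phi> \<psi>) = fv \<phi> \<union> fv \<psi>"
| "fv (BAll x y \<phi>) = insert y (fv \<phi> - {x})"
| "fv (BEx x y \<phi>) = insert y (fv \<phi> - {x})"
| "fv (All x \<phi>) = fv \<phi> - {x}"
| "fv (Ex x \<phi>) = fv \<phi> - {x}"

primrec delta0 :: "fm \<Rightarrow> bool" where
  "delta0 (Eq x y) \<longleftrightarrow> True"
| "delta0 (Mem x y) \<longleftrightarrow> True"
| "delta0 (Neg \<phi>) \<longleftrightarrow> delta0 \<phi>"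
| "delta0 (And \<phi> \<psi>) \<longleftrightarrow> delta0 \<phi> \<and> delta0 \<psi>"
| "delta0 (Or \<phi> \<psi>) \<longleftrightarrow> delta0 \<phi> \<and> delta0 \<psi>"
| "delta0 (Imp \<phi> \<psi>) \<longleftrightarrow> delta0 \<phi> \<and> delta0 \<psi>"
| "delta0 (Iff \<phi> \<psi>) \<longleftrightarrow> delta0 \<phi> \<and> delta0 \<psi>"
| "delta0 (BAll x y \<phi>) \<longleftrightarrow> delta0 \<phi>"
| "delta0 (BEx x y \<phi>) \<longleftrightarrow> delta0 \<phi>"
| "delta0 (All x \<phi>) \<longleftrightarrow> False"
| "delta0 (Ex x \<phi>) \<longleftrightarrow> False"

text \<open>
  \<open>truth Q \<phi> \<sigma>\<close> is the \<open>Q\<close>-value of \<open>\<phi>\<close> with the parameter \<open>\<sigma> x\<close> substituted for each free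
  variable \<open>x\<close>.
\<close>

primrec truth ::
  "'p::{order,uminus} set \<Rightarrow> fm \<Rightarrow> (nat \<Rightarrow> ('i, 'p) vset) \<Rightarrow> 'p"
where
  "truth Q (Eq x y) \<sigma> = veq Q (\<sigma> x) (\<sigma> y)"
| "truth Q (Mem x y) \<sigma> = vmem Q (\<sigma> x) (\<sigma> y)"
| "truth Q (Neg \<phi>) \<sigma> = - truth Q \<phi> \<sigma>"
| "truth Q (And \<phi> \<psi>) \<sigma> = meet_in Q (truth Q \<phi> \<sigma>) (truth Q \<psi> \<sigma>)"
| "truth Q (Or \<phi> \<psi>) \<sigma> = join_in Q (truth Q \<phi> \<sigma>) (truth Q \<psi> \<sigma>)"
| "truth Q (Imp \<phi> \<psi>) \<sigma> = imp_in Q (truth Q \<phi> \<sigma>) (truth Q \<psi> \<sigma>)"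
| "truth Q (Iff \<phi> \<psi>) \<sigma> = iff_in Q (truth Q \<phi> \<sigma>) (truth Q \<psi> \<sigma>)"
| "truth Q (BAll x y \<phi>) \<sigma> =
     glb_in Q ((\<lambda>u. imp_in Q (the (vfun (\<sigma> y) u)) (truth Q \<phi> (\<sigma>(x := u)))) ` dom (vfun (\<sigma> y)))"
| "truth Q (BEx x y \<phi>) \<sigma> =
     lub_in Q ((\<lambda>u. meet_in Q (the (vfun (\<sigma> y) u)) (truth Q \<phi> (\<sigma>(x := u)))) ` dom (vfun (\<sigma> y)))"
| "truth Q (All x \<phi>) \<sigma> = glb_in Q ((\<lambda>u. truth Q \<phi> (\<sigma>(x := u))) ` V Q)"
| "truth Q (Ex x \<phi>) \<sigma> = lub_in Q ((\<lambda>u. truth Q \<phi> (\<sigma>(x := u))) ` V Q)"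

end

theory Submission
  imports Defs
begin

text \<open>
  A logic, being a commutant, is closed under the infima, suprema and complements of the lattice of
  all projections, so its own operations are the restrictions of the ambient ones. The clauses for
  \<open>\<Delta>\<^sub>0\<close>-formulas only quantify over domains of parameters, which do not depend on the logic.
\<close>

section \<open>Completely closed sets of projections\<close>

definition completely_closed :: "'p::{complete_lattice,uminus} set \<Rightarrow> bool" where
  "completely_closed Q \<longleftrightarrow>
     (\<forall>A\<subseteq>Q. Inf A \<in> Q) \<and> (\<forall>A\<subseteq>Q. Sup A \<in> Q) \<and> (\<forall>p\<in>Q. - p \<in> Q)"

text \<open>A self-adjoint operator leaving a closed subspace invariant also leaves its orthogonal
  complement invariant.\<close>

lemma commute_if_invariant:
  assumes inv: "\<And>x. x \<in> prange M \<Longrightarrow> papply R x \<in> prange M"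
  shows "papply M \<circ> papply R = papply R \<circ> papply M"
proof -
  have 1: "papply M (papply R (papply M x)) = papply R (papply M x)" for x
    using inv[of "papply M x"] by (simp add: prange_iff[symmetric])
  have "papply M (papply R y) = papply M (papply R (papply M y))" for y
  proof -
    let ?d = "papply M (papply R y) - papply M (papply R (papply M y))"
    have "cinner x ?d = 0" for x
      using 1 by (metis cinner_diff_right diff_self papply_selfadjoint)
    then have "?d = 0"
      by (rule cinner_self_eq_0)
    then show ?thesis
      by simp
  qed
  then show ?thesis
    by (simp add: fun_eq_iff 1)
qed

lemma invariant_if_commute:
  assumes "papply P \<circ> papply R = papply R \<circ> papply P" and "x \<in> prange P"
  shows "papply R x \<in> prange P"
  using assms by (metis comp_apply prange_iff)

lemma commutant_Inf:
  assumes "A \<subseteq> commutant B"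
  shows "Inf A \<in> commutant B"
  unfolding commutant_def
proof (intro CollectI ballI commute_if_invariant)
  fix R x assume "R \<in> B" "x \<in> prange (Inf A)"
  with assms show "papply R x \<in> prange (Inf A)"
    unfolding prange_Inf commutant_def by (blast intro: invariant_if_commute)
qed

lemma commutant_Sup:
  assumes "A \<subseteq> commutant B"
  shows "Sup A \<in> commutant B"
  unfolding commutant_def
proof (intro CollectI ballI commute_if_invariant)
  fix R x assume R: "R \<in> B" and x: "x \<in> prange (Sup A)"
  interpret R: bounded_linear "papply R"
    by (rule papply_bounded_linear)
  let ?T = "papply R -` prange (Sup A)"
  have "closure (cvs.span (\<Union>P\<in>A. prange P)) \<subseteq> ?T"
  proof (intro closure_minimal cvs.span_minimal)
    show "(\<Union>P\<in>A. prange P) \<subseteq> ?T"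
    proof
      fix y assume "y \<in> (\<Union>P\<in>A. prange P)"
      then obtain P where P: "P \<in> A" "y \<in> prange P"
        by blast
      then have "papply R y \<in> prange P"
        using assms R by (intro invariant_if_commute) (auto simp: commutant_def)
      with P proj_Sup_upper[of P A] show "y \<in> ?T"
        unfolding less_eq_proj_def by blast
    qed
    show "cvs.subspace ?T"
      using csubspace_prange[of "Sup A"]
      unfolding cvs.subspace_def by (simp only: vimage_eq R.zero R.add papply_scaleC) blast
    show "closed ?T"
      by (intro closed_vimage closed_prange linear_continuous_on papply_bounded_linear)
  qed
  with x show "papply R x \<in> prange (Sup A)"
    unfolding prange_Sup by blast
qed

lemma commutant_uminus:
  assumes "P \<in> commutant B"
  shows "- P \<in> commutant B"
proof -
  have "papply (- P) \<circ> papply R = papply R \<circ> papply (- P)" if "R \<in> B" for R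
    using assms that papply_bounded_linear[of R]
    by (auto simp: commutant_def uminus_proj.rep_eq fun_eq_iff linear_simps)
  then show ?thesis
    by (simp add: commutant_def)
qed

lemma completely_closed_commutant: "completely_closed (commutant B)"
  unfolding completely_closed_def by (blast intro: commutant_Inf commutant_Sup commutant_uminus)

lemma completely_closed_logic: "logic Q \<Longrightarrow> completely_closed Q"
  by (metis logic_def completely_closed_commutant)

section \<open>Operations in a completely closed set\<close>

lemma glb_in_eq_Inf:
  assumes "completely_closed Q" and "A \<subseteq> Q"
  shows "glb_in Q A = Inf A"
proof -
  have "Inf A \<in> Q"
    using assms by (simp add: completely_closed_def)
  then show ?thesis
    unfolding glb_in_def
    by (intro the_equality) (auto intro: Inf_lower Inf_greatest antisym)
qed

lemma lub_in_eq_Sup: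
  assumes "completely_closed Q" and "A \<subseteq> Q"
  shows "lub_in Q A = Sup A"
proof -
  have "Sup A \<in> Q"
    using assms by (simp add: completely_closed_def)
  then show ?thesis
    unfolding lub_in_def
    by (intro the_equality) (auto intro: Sup_upper Sup_least antisym)
qed

text \<open>\<open>agree Q a b\<close> carries membership in \<open>Q\<close> along with equality, since the operations in \<open>Q\<close>
  have junk values outside \<open>Q\<close>.\<close>

definition agree :: "'p set \<Rightarrow> 'p \<Rightarrow> 'p \<Rightarrow> bool" where
  "agree Q a b \<longleftrightarrow> a = b \<and> a \<in> Q"

lemma agree_uminus: "completely_closed Q \<Longrightarrow> agree Q a b \<Longrightarrow> agree Q (- a) (- b)"
  by (auto simp: agree_def completely_closed_def)

lemma agree_glb:
  assumes Q: "completely_closed Q" and "\<And>i. i \<in> I \<Longrightarrow> agree Q (f i) (g i)"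
  shows "agree Q (glb_in Q (f ` I)) (glb_in UNIV (g ` I))"
proof -
  have "f ` I = g ` I" "f ` I \<subseteq> Q"
    using assms(2) unfolding agree_def by (force intro!: image_cong)+
  with Q show ?thesis
    by (metis agree_def completely_closed_def glb_in_UNIV glb_in_eq_Inf)
qed

lemma agree_lub:
  assumes Q: "completely_closed Q" and "\<And>i. i \<in> I \<Longrightarrow> agree Q (f i) (g i)"
  shows "agree Q (lub_in Q (f ` I)) (lub_in UNIV (g ` I))"
proof -
  have "f ` I = g ` I" "f ` I \<subseteq> Q"
    using assms(2) unfolding agree_def by (force intro!: image_cong)+
  with Q show ?thesis
    by (metis agree_def completely_closed_def lub_in_UNIV lub_in_eq_Sup)
qed

lemma agree_meet:
  assumes "completely_closed Q" "agree Q a a'" "agree Q b b'"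
  shows "agree Q (meet_in Q a b) (meet_in UNIV a' b')"
  using agree_glb[of Q "{a, b}" id id] assms by (auto simp: meet_in_def agree_def)

lemma agree_join:
  assumes "completely_closed Q" "agree Q a a'" "agree Q b b'"
  shows "agree Q (join_in Q a b) (join_in UNIV a' b')"
  using agree_lub[of Q "{a, b}" id id] assms by (auto simp: join_in_def agree_def)

lemma agree_imp:
  assumes "completely_closed Q" "agree Q a a'" "agree Q b b'"
  shows "agree Q (imp_in Q a b) (imp_in UNIV a' b')"
  unfolding imp_in_def by (intro agree_join agree_meet agree_uminus assms)

lemma agree_iff:
  assumes "completely_closed Q" "agree Q a a'" "agree Q b b'"
  shows "agree Q (iff_in Q a b) (iff_in UNIV a' b')"
  unfolding iff_in_def by (intro agree_imp agree_meet assms)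

section \<open>Absoluteness of truth values\<close>

lemma V_dom: "u \<in> V Q \<Longrightarrow> x \<in> dom (vfun u) \<Longrightarrow> x \<in> V Q"
  by (erule V.cases) blast

lemma agree_vfun: "u \<in> V Q \<Longrightarrow> x \<in> dom (vfun u) \<Longrightarrow> agree Q (the (vfun u x)) (the (vfun u x))"
  by (erule V.cases) (auto simp: agree_def ran_def)

lemma agree_veq_vmem:
  fixes u v :: "('i, 'p::{complete_lattice,uminus}) vset"
  shows "completely_closed Q \<Longrightarrow> u \<in> V Q \<Longrightarrow> v \<in> V Q \<Longrightarrow> agree Q (veq Q u v) (veq UNIV u v)"
    and "completely_closed Q \<Longrightarrow> u \<in> V Q \<Longrightarrow> v \<in> V Q \<Longrightarrow> agree Q (vmem Q u v) (vmem UNIV u v)"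
proof (induction Q u v and Q u v rule: veq_vmem.induct)
  case (1 Q u v)
  then show ?case
    unfolding veq.simps[of _ u v]
    by (intro agree_meet agree_glb agree_imp agree_vfun) (blast dest: V_dom)+
next
  case (2 Q u v)
  then show ?case
    unfolding vmem.simps[of _ u v]
    by (intro agree_meet agree_lub agree_vfun) (auto intro: V_dom)
qed

lemma agree_truth:
  fixes \<sigma> :: "nat \<Rightarrow> ('i, 'p::{complete_lattice,uminus}) vset"
  assumes Q: "completely_closed Q"
  shows "delta0 \<phi> \<Longrightarrow> (\<And>x. x \<in> fv \<phi> \<Longrightarrow> \<sigma> x \<in> V Q) \<Longrightarrow> agree Q (truth Q \<phi> \<sigma>) (truth UNIV \<phi> \<sigma>)"
proof (induction \<phi> arbitrary: \<sigma>)
  case (BAll x y \<phi>)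
  have y: "\<sigma> y \<in> V Q"
    using BAll.prems by simp
  then show ?case
    using BAll.prems unfolding truth.simps
    by (intro agree_glb agree_imp agree_vfun BAll.IH Q) (auto intro: V_dom[OF y])
next
  case (BEx x y \<phi>)
  have y: "\<sigma> y \<in> V Q"
    using BEx.prems by simp
  then show ?case
    using BEx.prems unfolding truth.simps
    by (intro agree_lub agree_meet agree_vfun BEx.IH Q) (auto intro: V_dom[OF y])
qed (simp_all add: Q agree_veq_vmem agree_uminus agree_meet agree_join agree_imp agree_iff)

theorem theorem3p2:
  fixes Q :: "'h::chilbert_space proj set"
    and \<phi> :: fm
    and \<sigma> :: "nat \<Rightarrow> ('i, 'h proj) vset"
  assumes "logic Q"
    and "delta0 \<phi>"
    and "\<And>x. x \<in> fv \<phi> \<Longrightarrow> \<sigma> x \<in> V Q"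
  shows "truth Q \<phi> \<sigma> = truth (UNIV :: 'h proj set) \<phi> \<sigma>"
  using agree_truth[OF completely_closed_logic[OF assms(1)] assms(2,3)] by (simp add: agree_def)

end
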